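(* For every connected graph $G$ of order at least two, $$\mathrm{rrad}(G) \le \mathrm{rdiam}(G) \le \mathrm{rrad}(G)+\mathrm{diam}(G),$$ and both bounds are sharp; that is, there exists a connected graph $G$ of order at least two with $\mathrm{rrad}(G)=\mathrm{rdiam}(G)$, and there exists a connected graph $G$ of order at least two with $\mathrm{rdiam}(G)=\mathrm{rrad}(G)+\mathrm{diam}(G)$.
   Context: All graphs are finite, simple, undirected. $d(x,y)$ is the length of a shortest path between $x$ and $y$, and $\mathrm{diam}(G)=\max_{x,y}d(x,y)$. A set $S\subseteq V(G)$ is a resolving set of $G$ if for every pair of distinct vertices $x,y$ of $G$ there is $z\in S$ with $d(x,z)\ne d(y,z)$; it is a connected resolving set if moreover the induced subgraph $G[S]$ is connected. For $v\in V(G)$, $\mathrm{cdim}_G(v)$ is the minimum cardinality of a connected resolving set of $G$ containing $v$. The resolving radius is $\mathrm{rrad}(G)=\min_{v\in V(G)}\mathrm{cdim}_G(v)$ and the resolving diameter is $\mathrm{rdiam}(G)=\max_{v\in V(G)}\mathrm{cdim}_G(v)$. *)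

theory Defs
  imports "Graph_Theory.Graph_Theory"
begin

text \<open>
  A finite simple undirected graph is a \<^locale>\<open>pair_graph\<close>, that is, a finite, symmetric,
  loop-free set of ordered pairs over a finite vertex set.  All minima and maxima below range
  over finite sets; these are nonempty if the graph is connected (which includes having
  a vertex), so for connected graphs no default value of \<^const>\<open>Least\<close>, \<^const>\<open>Min\<close>
  or \<^const>\<open>Max\<close> is involved.
\<close>

definition gdist :: "'a pair_pre_digraph \<Rightarrow> 'a \<Rightarrow> 'a \<Rightarrow> nat" where
  "gdist G x y = (LEAST n. \<exists>p. pre_digraph.apath (with_proj G) x p y \<and> length p = n)"

text \<open>
  On reachable pairs this is the library's shortest-path cost for unit weights, as a natural number.
\<close>

lemma gdist_eq_mu:
  assumes "pair_graph G" and "x \<rightarrow>\<^sup>*\<^bsub>with_proj G\<^esub> y"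
  shows "ereal (real (gdist G x y)) = wf_digraph.\<mu> (with_proj G) (\<lambda>_. 1) x y"
proof -
  interpret pair_graph G by fact
  have cost: "awalk_cost (\<lambda>_. 1) p = real (length p)" for p :: "('a \<times> 'a) list"
    by (induction p) auto
  obtain p where p: "apath x p y" "\<mu> (\<lambda>_. 1) x y = awalk_cost (\<lambda>_. 1) p"
    using min_cost_awalk[OF assms(2), of "\<lambda>_. 1"] by auto
  have "length p \<le> n" if "\<exists>q. apath x q y \<and> length q = n" for n
  proof -
    from that obtain q where q: "apath x q y" "length q = n" by blast
    then have "awalk x q y" by (simp add: apath_def)
    from min_cost_le_walk_cost[OF this, of "\<lambda>_. 1"] p(2) q(2) show ?thesis
      by (simp add: cost)
  qed
  then have "gdist G x y = length p"
    unfolding gdist_def using p(1) by (intro Least_equality) auto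
  then show ?thesis using p(2) by (simp add: cost)
qed

definition gdiam :: "'a pair_pre_digraph \<Rightarrow> nat" where
  "gdiam G = Max {gdist G x y | x y. x \<in> pverts G \<and> y \<in> pverts G}"

definition resolving_set :: "'a pair_pre_digraph \<Rightarrow> 'a set \<Rightarrow> bool" where
  "resolving_set G S \<longleftrightarrow> S \<subseteq> pverts G \<and>
     (\<forall>x\<in>pverts G. \<forall>y\<in>pverts G. x \<noteq> y \<longrightarrow> (\<exists>z\<in>S. gdist G x z \<noteq> gdist G y z))"

definition connected_resolving_set :: "'a pair_pre_digraph \<Rightarrow> 'a set \<Rightarrow> bool" where
  "connected_resolving_set G S \<longleftrightarrow> resolving_set G S \<and> Digraph_Component.connected (with_proj G \<restriction> S)"

definition cdim :: "'a pair_pre_digraph \<Rightarrow> 'a \<Rightarrow> nat" where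
  "cdim G v = Min (card ` {S. connected_resolving_set G S \<and> v \<in> S})"

definition rrad :: "'a pair_pre_digraph \<Rightarrow> nat" where
  "rrad G = Min (cdim G ` pverts G)"

definition rdiam :: "'a pair_pre_digraph \<Rightarrow> nat" where
  "rdiam G = Max (cdim G ` pverts G)"

end

theory Submission
  imports Defs
begin

text \<open>
  The upper bound rests on two monotonicity facts: a superset of a resolving set is resolving, and
  attaching a walk to a connected vertex set keeps it connected.  So take a smallest connected
  resolving set \<open>S\<close>, which has \<open>rrad G\<close> elements, and join a given vertex \<open>v\<close> to it by a shortest
  path.  This adds at most one vertex per arc of the path, hence at most \<open>gdiam G\<close> vertices
  (\<open>cdim_le_card_plus_gdist\<close>), and the result is a connected resolving set containing \<open>v\<close>.

  In the complete graph on two vertices every vertex is a resolving set by itself, so radius and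
  diameter are both \<open>1\<close>.  For the upper bound, take the path \<open>3 - 2 - 1 - 4\<close>, join all its
  vertices to a hub \<open>0\<close>, and hang a leaf \<open>5\<close> on the hub.  This graph has diameter \<open>2\<close>, and
  \<open>{1, 2}\<close> is a connected resolving set.  A connected resolving set containing the leaf must
  contain the hub as well, but each of the two has equal distance to all path vertices, and a
  single further vertex does not separate them; so four vertices are necessary
  (\<open>leafed_fan_cdim_leaf\<close>).  The gap between \<open>4\<close> and \<open>2\<close> is the diameter.
\<close>

section \<open>Connectivity of induced subgraphs\<close>

text \<open>
  Connectivity is defined by reachability in the symmetrised digraph.  The arcs of an undirected
  graph are symmetric already, so symmetrisation adds none, and what remains is the reflexive
  transitive closure of the arcs inside the set.
\<close>

lemma connected_induce_subgraph_iff: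
  assumes "pair_graph G"
  shows "Digraph_Component.connected (with_proj G \<restriction> S) \<longleftrightarrow>
    S \<noteq> {} \<and> (\<forall>x\<in>S. \<forall>y\<in>S. (x, y) \<in> (parcs G \<inter> S \<times> S)\<^sup>*)"
proof -
  interpret pair_graph G by fact
  have arcs: "parcs (mk_symmetric (with_proj G \<restriction> S)) = parcs G \<inter> S \<times> S"
    unfolding parcs_mk_symmetric by (auto intro: arcs_symmetric)
  interpret M: pair_wf_digraph "mk_symmetric (with_proj G \<restriction> S)"
    by (rule wf_digraph.wellformed_mk_symmetric) (rule wellformed_induce_subgraph)
  show ?thesis
    unfolding Digraph_Component.connected_def strongly_connected_def
    by (auto simp: M.reachable_conv arcs Int_assoc)
qed

lemma connected_iff_induce_pverts:
  assumes "pair_graph G"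
  shows "Digraph_Component.connected (with_proj G) \<longleftrightarrow>
    Digraph_Component.connected (with_proj G \<restriction> pverts G)"
proof -
  interpret pair_graph G by fact
  have "with_proj G \<restriction> pverts G = with_proj G"
    unfolding induce_subgraph_def with_proj_def
    by (auto dest: arc_fst_in_verts arc_snd_in_verts)
  then show ?thesis by simp
qed

lemma connected_induce_insert:
  assumes G: "pair_graph G" and S: "Digraph_Component.connected (with_proj G \<restriction> S)"
    and u: "u \<in> S" and vu: "(v, u) \<in> parcs G"
  shows "Digraph_Component.connected (with_proj G \<restriction> insert v S)"
proof -
  interpret pair_graph G by fact
  let ?R = "parcs G \<inter> S \<times> S" and ?R' = "parcs G \<inter> insert v S \<times> insert v S"
  have "?R\<^sup>* \<subseteq> ?R'\<^sup>*" by (intro rtrancl_mono) auto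
  then have old: "(x, y) \<in> ?R'\<^sup>*" if "x \<in> S" "y \<in> S" for x y
    using S that unfolding connected_induce_subgraph_iff[OF G] by blast
  have arcs: "(v, u) \<in> ?R'" "(u, v) \<in> ?R'" using u vu by (auto intro: arcs_symmetric)
  have "(v, y) \<in> ?R'\<^sup>*" "(y, v) \<in> ?R'\<^sup>*" if "y \<in> S" for y
    using old[OF u that] old[OF that u] arcs
    by (auto intro: converse_rtrancl_into_rtrancl rtrancl_into_rtrancl)
  with old show ?thesis unfolding connected_induce_subgraph_iff[OF G] by auto
qed

section \<open>Distances\<close>

lemma gdist_le_length:
  assumes "pre_digraph.apath (with_proj G) x p y"
  shows "gdist G x y \<le> length p"
  unfolding gdist_def using assms by (intro Least_le) auto

lemma connected_imp_shortest_apath: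
  assumes "pair_graph G" and "Digraph_Component.connected (with_proj G)"
    and "x \<in> pverts G" "y \<in> pverts G"
  obtains p where "pre_digraph.apath (with_proj G) x p y" "length p = gdist G x y"
proof -
  interpret pair_graph G by fact
  have "strongly_connected (with_proj G)"
    using assms(2) sym_arcs by (rule symmetric_connected_imp_strongly_connected[rotated])
  then have "x \<rightarrow>\<^sup>*\<^bsub>with_proj G\<^esub> y" using assms(3,4) by auto
  then have "\<exists>n p. apath x p y \<and> length p = n" using reachable_apath by blast
  from LeastI_ex[OF this] show ?thesis using that unfolding gdist_def by blast
qed

lemma gdist_eq_0_iff:
  assumes "pair_graph G" and "Digraph_Component.connected (with_proj G)"
    and "x \<in> pverts G" "y \<in> pverts G"
  shows "gdist G x y = 0 \<longleftrightarrow> x = y"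
proof -
  interpret pair_graph G by fact
  obtain p where "apath x p y" "length p = gdist G x y"
    using connected_imp_shortest_apath[OF assms] by blast
  moreover have "apath x [] x" using assms(3) by (simp add: apath_simps)
  ultimately show ?thesis
    using gdist_le_length[of G x "[]" y] by (auto simp: apath_simps)
qed

lemma finite_gdist_values:
  assumes "pair_graph G"
  shows "finite {gdist G x y | x y. x \<in> pverts G \<and> y \<in> pverts G}"
proof -
  interpret pair_graph G by fact
  have "{gdist G x y | x y. x \<in> pverts G \<and> y \<in> pverts G}
      = (\<lambda>(x, y). gdist G x y) ` (pverts G \<times> pverts G)" by auto
  then show ?thesis by (simp add: pair_finite_verts)
qed

lemma gdist_le_gdiam:
  assumes "pair_graph G" and "x \<in> pverts G" "y \<in> pverts G"
  shows "gdist G x y \<le> gdiam G"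
  unfolding gdiam_def using assms by (intro Max_ge finite_gdist_values) auto

section \<open>Connected resolving sets through a vertex\<close>

lemma connected_resolving_set_pverts:
  assumes "pair_graph G" and "Digraph_Component.connected (with_proj G)"
  shows "connected_resolving_set G (pverts G)"
proof -
  have "resolving_set G (pverts G)"
    unfolding resolving_set_def using gdist_eq_0_iff[OF assms] by (metis order_refl)
  then show ?thesis
    unfolding connected_resolving_set_def using assms connected_iff_induce_pverts by blast
qed

lemma finite_card_connected_resolving_sets:
  assumes "pair_graph G"
  shows "finite (card ` {S. connected_resolving_set G S \<and> v \<in> S})"
proof -
  interpret pair_graph G by fact
  have "{S. connected_resolving_set G S \<and> v \<in> S} \<subseteq> Pow (pverts G)"
    by (auto simp: connected_resolving_set_def resolving_set_def)
  then show ?thesis using pair_finite_verts by (meson finite_Pow_iff finite_imageI finite_subset)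
qed

lemma cdim_le_card:
  assumes "pair_graph G" and "connected_resolving_set G S" and "v \<in> S"
  shows "cdim G v \<le> card S"
  unfolding cdim_def using assms by (intro Min_le finite_card_connected_resolving_sets) auto

lemma cdim_attained:
  assumes "pair_graph G" and "Digraph_Component.connected (with_proj G)" and "v \<in> pverts G"
  obtains S where "connected_resolving_set G S" "v \<in> S" "card S = cdim G v"
proof -
  have "cdim G v \<in> card ` {S. connected_resolving_set G S \<and> v \<in> S}"
    unfolding cdim_def using connected_resolving_set_pverts[OF assms(1,2)] assms(3)
    by (intro Min_in finite_card_connected_resolving_sets assms(1)) auto
  then show ?thesis using that by auto
qed

lemma resolving_set_mono:
  assumes "resolving_set G S" and "S \<subseteq> T" and "T \<subseteq> pverts G"
  shows "resolving_set G T"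
  using assms unfolding resolving_set_def by blast

text \<open>
  A walk ending in a connected resolving set can be absorbed into it, starting at its last
  arc; vertices that occur twice or already lie in the set only make the result smaller.
\<close>

lemma connected_resolving_set_extend_along_awalk:
  assumes G: "pair_graph G" and S: "connected_resolving_set G S" and s: "s \<in> S"
    and "pre_digraph.awalk (with_proj G) v p s"
  shows "\<exists>T. connected_resolving_set G T \<and> v \<in> T \<and> card T \<le> card S + length p"
proof -
  interpret pair_graph G by fact
  show ?thesis using assms(4)
  proof (induction p arbitrary: v)
    case Nil
    then show ?case using S s by (auto simp: awalk_simps)
  next
    case (Cons e p)
    then have e: "(v, snd e) \<in> parcs G" and "awalk (snd e) p s"
      by (auto simp: awalk_simps)
    from Cons.IH[OF this(2)] obtain T where T: "connected_resolving_set G T" "snd e \<in> T"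
      "card T \<le> card S + length p" by blast
    have "connected_resolving_set G (insert v T)"
      using T(1) connected_induce_insert[OF G _ T(2) e] in_arcsD1[OF e]
        resolving_set_mono[of G T "insert v T"]
      unfolding connected_resolving_set_def by (auto simp: resolving_set_def)
    moreover have "card (insert v T) \<le> Suc (card T)" by (rule card_insert_le_m1) auto
    ultimately show ?case using T(3)
      by (intro exI[of _ "insert v T"]) auto
  qed
qed

lemma cdim_le_card_plus_gdist:
  assumes G: "pair_graph G" and conn: "Digraph_Component.connected (with_proj G)"
    and S: "connected_resolving_set G S" and s: "s \<in> S" and v: "v \<in> pverts G"
  shows "cdim G v \<le> card S + gdist G v s"
proof -
  have "s \<in> pverts G"
    using S s by (auto simp: connected_resolving_set_def resolving_set_def)
  then obtain p where p: "pre_digraph.apath (with_proj G) v p s" "length p = gdist G v s"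
    using connected_imp_shortest_apath[OF G conn v] by blast
  obtain T where "connected_resolving_set G T" "v \<in> T" "card T \<le> card S + length p"
    using connected_resolving_set_extend_along_awalk[OF G S s pre_digraph.awalkI_apath[OF p(1)]]
    by blast
  then show ?thesis using cdim_le_card[OF G] p(2) by fastforce
qed

lemma cdim_pos:
  assumes "pair_graph G" and "Digraph_Component.connected (with_proj G)" and "v \<in> pverts G"
  shows "1 \<le> cdim G v"
proof -
  interpret pair_graph G by fact
  obtain S where "connected_resolving_set G S" "v \<in> S" "card S = cdim G v"
    using cdim_attained[OF assms] by blast
  moreover from this have "finite S"
    using pair_finite_verts
    by (auto simp: connected_resolving_set_def resolving_set_def intro: finite_subset)
  ultimately show ?thesis by (metis One_nat_def Suc_leI card_gt_0_iff empty_iff)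
qed

section \<open>Resolving radius and resolving diameter\<close>

lemma rrad_le_cdim:
  assumes "pair_graph G" and "v \<in> pverts G"
  shows "rrad G \<le> cdim G v"
proof -
  interpret pair_graph G by fact
  show ?thesis unfolding rrad_def using assms pair_finite_verts by auto
qed

lemma cdim_le_rdiam:
  assumes "pair_graph G" and "v \<in> pverts G"
  shows "cdim G v \<le> rdiam G"
proof -
  interpret pair_graph G by fact
  show ?thesis unfolding rdiam_def using assms pair_finite_verts by auto
qed

lemma connected_imp_pverts_nonempty:
  assumes "Digraph_Component.connected (with_proj G)"
  shows "pverts G \<noteq> {}"
  using assms by (auto simp: Digraph_Component.connected_def strongly_connected_def)

lemma rrad_le_rdiam:
  assumes "pair_graph G" and "Digraph_Component.connected (with_proj G)"
  shows "rrad G \<le> rdiam G"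
  using connected_imp_pverts_nonempty[OF assms(2)] rrad_le_cdim[OF assms(1)]
    cdim_le_rdiam[OF assms(1)] by (meson all_not_in_conv order_trans)

lemma rdiam_le_rrad_plus_gdiam:
  assumes G: "pair_graph G" and conn: "Digraph_Component.connected (with_proj G)"
  shows "rdiam G \<le> rrad G + gdiam G"
proof -
  interpret pair_graph G by fact
  have fin: "finite (cdim G ` pverts G)" and ne: "cdim G ` pverts G \<noteq> {}"
    using pair_finite_verts connected_imp_pverts_nonempty[OF conn] by auto
  obtain c where c: "c \<in> pverts G" "rrad G = cdim G c"
    using Min_in[OF fin ne] unfolding rrad_def by auto
  obtain S where S: "connected_resolving_set G S" "c \<in> S" "card S = rrad G"
    using cdim_attained[OF G conn c(1)] c(2) by metis
  have "cdim G v \<le> rrad G + gdiam G" if v: "v \<in> pverts G" for v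
    using cdim_le_card_plus_gdist[OF G conn S(1,2) v] gdist_le_gdiam[OF G v c(1)] S(3) by simp
  then show ?thesis unfolding rdiam_def using fin ne by simp
qed

section \<open>Graphs with a hub\<close>

text \<open>
  In both extremal graphs one vertex is adjacent to all others.  This makes distances a
  matter of looking up arcs.
\<close>

lemma hub_imp_connected:
  assumes "pair_graph G" and "h \<in> pverts G" and hub: "\<And>v. v \<in> pverts G \<Longrightarrow> v \<noteq> h \<Longrightarrow> (h, v) \<in> parcs G"
  shows "Digraph_Component.connected (with_proj G)"
proof -
  interpret pair_graph G by fact
  let ?R = "parcs G \<inter> pverts G \<times> pverts G"
  have "(h, v) \<in> ?R\<^sup>*" "(v, h) \<in> ?R\<^sup>*" if "v \<in> pverts G" for v
    using hub[OF that] arcs_symmetric[of h v] that assms(2) by (cases "v = h"; blast)+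
  then have "(x, y) \<in> ?R\<^sup>*" if "x \<in> pverts G" "y \<in> pverts G" for x y
    using that by (meson rtrancl_trans)
  then show ?thesis
    unfolding connected_iff_induce_pverts[OF assms(1)] connected_induce_subgraph_iff[OF assms(1)]
    using assms(2) by blast
qed

lemma hub_gdist:
  assumes G: "pair_graph G" and h: "h \<in> pverts G"
    and hub: "\<And>v. v \<in> pverts G \<Longrightarrow> v \<noteq> h \<Longrightarrow> (h, v) \<in> parcs G"
    and x: "x \<in> pverts G" and y: "y \<in> pverts G"
  shows "gdist G x y = (if x = y then 0 else if (x, y) \<in> parcs G then 1 else 2)"
proof -
  interpret pair_graph G by fact
  have conn: "Digraph_Component.connected (with_proj G)" by (rule hub_imp_connected[OF G h hub])
  obtain p where p: "apath x p y" "length p = gdist G x y"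
    using connected_imp_shortest_apath[OF G conn x y] by blast
  consider "x = y" | "x \<noteq> y" "(x, y) \<in> parcs G" | "x \<noteq> y" "(x, y) \<notin> parcs G" by blast
  then show ?thesis
  proof cases
    case 1
    then show ?thesis using gdist_eq_0_iff[OF G conn x y] by simp
  next
    case 2
    then have "apath x [(x, y)] y" using y by (simp add: apath_simps)
    from gdist_le_length[OF this] show ?thesis
      using 2 gdist_eq_0_iff[OF G conn x y] by simp
  next
    case 3
    then have "x \<noteq> h" "y \<noteq> h" using hub x y arcs_symmetric by blast+
    then have "apath x [(x, h), (h, y)] y"
      using 3(1) hub x y arcs_symmetric by (auto simp: apath_simps)
    from gdist_le_length[OF this] have "gdist G x y \<le> 2" by simp
    moreover have "gdist G x y \<noteq> 1"
      using p 3(2) by (cases p) (auto simp: apath_simps)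
    ultimately show ?thesis using 3 gdist_eq_0_iff[OF G conn x y] by simp
  qed
qed

section \<open>Equality in the lower bound\<close>

definition edge_graph :: "nat pair_pre_digraph" where
  "edge_graph = \<lparr>pverts = {0, 1}, parcs = {(0, 1), (1, 0)}\<rparr>"

lemma edge_graph_pair_graph: "pair_graph edge_graph"
  by unfold_locales (auto simp: edge_graph_def symmetric_def intro: symI)

lemma edge_graph_connected: "Digraph_Component.connected (with_proj edge_graph)"
  by (rule hub_imp_connected[OF edge_graph_pair_graph, of 0]) (auto simp: edge_graph_def)

lemma edge_graph_cdim:
  assumes v: "v \<in> pverts edge_graph"
  shows "cdim edge_graph v = 1"
proof -
  have dist: "gdist edge_graph x y = (if x = y then 0 else 1)"
    if "x \<in> pverts edge_graph" "y \<in> pverts edge_graph" for x y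
    using that by (subst hub_gdist[OF edge_graph_pair_graph, of 0]) (auto simp: edge_graph_def)
  have "resolving_set edge_graph {v}"
    unfolding resolving_set_def using v dist by (auto simp: edge_graph_def)
  then have "connected_resolving_set edge_graph {v}"
    by (simp add: connected_resolving_set_def
        connected_induce_subgraph_iff[OF edge_graph_pair_graph])
  from cdim_le_card[OF edge_graph_pair_graph this] show ?thesis
    using cdim_pos[OF edge_graph_pair_graph edge_graph_connected v] by simp
qed

lemma edge_graph_rrad_eq_rdiam: "rrad edge_graph = rdiam edge_graph"
proof -
  have "cdim edge_graph ` pverts edge_graph = {1}"
    using edge_graph_cdim by (force simp: edge_graph_def)
  then show ?thesis by (simp add: rrad_def rdiam_def)
qed

section \<open>Equality in the upper bound\<close>

definition leafed_fan :: "nat pair_pre_digraph" where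
  "leafed_fan = \<lparr>pverts = {0, 1, 2, 3, 4, 5},
     parcs = (let E = {(0, 1), (0, 2), (0, 3), (0, 4), (0, 5), (3, 2), (2, 1), (1, 4)}
              in E \<union> E\<inverse>)\<rparr>"

lemma leafed_fan_pverts: "pverts leafed_fan = {0, 1, 2, 3, 4, 5}"
  by (simp add: leafed_fan_def)

lemma leafed_fan_parcs_iff:
  "(x, y) \<in> parcs leafed_fan \<longleftrightarrow>
    (x, y) \<in> {(0, 1), (0, 2), (0, 3), (0, 4), (0, 5), (3, 2), (2, 1), (1, 4)} \<or>
    (y, x) \<in> {(0, 1), (0, 2), (0, 3), (0, 4), (0, 5), (3, 2), (2, 1), (1, 4)}"
  unfolding leafed_fan_def Let_def by simp

lemma leafed_fan_pair_graph: "pair_graph leafed_fan"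
  by unfold_locales
    (auto simp: leafed_fan_def symmetric_def Let_def intro!: symI)

lemma leafed_fan_connected: "Digraph_Component.connected (with_proj leafed_fan)"
  by (rule hub_imp_connected[OF leafed_fan_pair_graph, of 0]) (auto simp: leafed_fan_pverts leafed_fan_parcs_iff)

lemma leafed_fan_gdist:
  assumes "x \<in> pverts leafed_fan" "y \<in> pverts leafed_fan"
  shows "gdist leafed_fan x y = (if x = y then 0 else if (x, y) \<in> parcs leafed_fan then 1 else 2)"
  by (rule hub_gdist[OF leafed_fan_pair_graph, of 0]) (use assms in \<open>auto simp: leafed_fan_pverts leafed_fan_parcs_iff\<close>)

lemma leafed_fan_gdiam_le: "gdiam leafed_fan \<le> 2"
proof -
  have "0 \<in> pverts leafed_fan" by (simp add: leafed_fan_pverts)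
  then have ne: "{gdist leafed_fan x y | x y. x \<in> pverts leafed_fan \<and> y \<in> pverts leafed_fan} \<noteq> {}"
    by blast
  show ?thesis
    unfolding gdiam_def Max_le_iff[OF finite_gdist_values[OF leafed_fan_pair_graph] ne]
    by (auto simp: leafed_fan_gdist)
qed

text \<open>
  The pairs of distances to \<open>1\<close> and \<open>2\<close>, in this order, are \<open>(1, 1)\<close> for the hub, \<open>(2, 1)\<close> and \<open>(1, 2)\<close> for the two ends
  \<open>3\<close> and \<open>4\<close> of the path, and \<open>(2, 2)\<close> for the leaf.
\<close>

lemma leafed_fan_rrad_le: "rrad leafed_fan \<le> 2"
proof -
  have "resolving_set leafed_fan {1, 2}"
    unfolding resolving_set_def
    by (simp add: leafed_fan_gdist leafed_fan_pverts leafed_fan_parcs_iff)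
  moreover have "Digraph_Component.connected (with_proj leafed_fan \<restriction> {1, 2})"
    unfolding connected_induce_subgraph_iff[OF leafed_fan_pair_graph]
    by (auto simp: leafed_fan_parcs_iff)
  ultimately have "connected_resolving_set leafed_fan {1, 2}"
    by (simp add: connected_resolving_set_def)
  then have "cdim leafed_fan 1 \<le> card {1, 2 :: nat}"
    by (rule cdim_le_card[OF leafed_fan_pair_graph]) simp
  moreover have "rrad leafed_fan \<le> cdim leafed_fan 1"
    by (rule rrad_le_cdim[OF leafed_fan_pair_graph]) (simp add: leafed_fan_pverts)
  ultimately show ?thesis by simp
qed

text \<open>
  Hub and leaf separate no two path vertices.  If \<open>a\<close> is a path vertex, it separates the other
  three only into its neighbours and its non-neighbours, so two of them stay together.
\<close>

lemma leafed_fan_hub_leaf_plus_one_not_resolving: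
  assumes S: "resolving_set leafed_fan S" and sub: "S \<subseteq> {0, 5, a}"
  shows False
proof -
  let ?unseparated = "\<lambda>x y. x \<in> pverts leafed_fan \<and> y \<in> pverts leafed_fan \<and> x \<noteq> y \<and>
    (\<forall>z\<in>{0, 5, a} \<inter> pverts leafed_fan. gdist leafed_fan x z = gdist leafed_fan y z)"
  consider "a = 1" | "a = 2" | "a = 3" | "a \<notin> {1, 2, 3}" by blast
  then have "\<exists>x y. ?unseparated x y"
  proof cases
    case 1
    then have "?unseparated 2 4" by (simp add: leafed_fan_gdist leafed_fan_pverts leafed_fan_parcs_iff)
    then show ?thesis by blast
  next
    case 2
    then have "?unseparated 1 3" by (simp add: leafed_fan_gdist leafed_fan_pverts leafed_fan_parcs_iff)
    then show ?thesis by blast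
  next
    case 3
    then have "?unseparated 1 4" by (simp add: leafed_fan_gdist leafed_fan_pverts leafed_fan_parcs_iff)
    then show ?thesis by blast
  next
    case 4
    \<comment> \<open>The end \<open>4\<close> is adjacent to neither \<open>2\<close> nor \<open>3\<close>; any other remaining \<open>a\<close> is hub, leaf or no vertex.\<close>
    then have "?unseparated 2 3" by (auto simp: leafed_fan_gdist leafed_fan_pverts leafed_fan_parcs_iff)
    then show ?thesis by blast
  qed
  moreover have "S \<subseteq> {0, 5, a} \<inter> pverts leafed_fan"
    using S sub by (auto simp: resolving_set_def)
  ultimately show False using S unfolding resolving_set_def by (metis subsetD)
qed

lemma leafed_fan_cdim_leaf: "4 \<le> cdim leafed_fan 5"
proof (rule ccontr)
  assume "\<not> 4 \<le> cdim leafed_fan 5"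
  moreover obtain S where S: "connected_resolving_set leafed_fan S" "5 \<in> S"
      "card S = cdim leafed_fan 5"
    using cdim_attained[OF leafed_fan_pair_graph leafed_fan_connected, of 5]
    by (auto simp: leafed_fan_pverts)
  ultimately have card: "card S \<le> 3" by simp
  have res: "resolving_set leafed_fan S" using S(1) by (simp add: connected_resolving_set_def)
  have fin: "finite S"
    using res by (auto simp: resolving_set_def leafed_fan_pverts intro: finite_subset)
  have "\<exists>a. S \<subseteq> {0, 5, a}"
  proof (cases "0 \<in> S")
    case True
    then have "card (S - {0, 5}) \<le> Suc 0"
      using S(2) fin card by (subst card_Diff_subset) auto
    then show ?thesis using card_le_Suc0_iff_eq[of "S - {0, 5}"] fin by blast
  next
    case False
    \<comment> \<open>Without the hub, the leaf is isolated in the induced subgraph.\<close>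
    have "y = 5" if "y \<in> S" for y
    proof (rule ccontr)
      assume "y \<noteq> 5"
      have "(5, y) \<in> (parcs leafed_fan \<inter> S \<times> S)\<^sup>*"
        using S(1,2) that
        unfolding connected_resolving_set_def connected_induce_subgraph_iff[OF leafed_fan_pair_graph]
        by blast
      with \<open>y \<noteq> 5\<close> obtain z where "(5, z) \<in> parcs leafed_fan" "z \<in> S"
        by (metis (no_types, lifting) IntD1 IntD2 converse_rtranclE mem_Sigma_iff)
      with False show False by (auto simp: leafed_fan_parcs_iff)
    qed
    then show ?thesis by blast
  qed
  with leafed_fan_hub_leaf_plus_one_not_resolving[OF res] show False by blast
qed

lemma leafed_fan_rdiam_eq: "rdiam leafed_fan = rrad leafed_fan + gdiam leafed_fan"
proof (rule antisym)
  show "rdiam leafed_fan \<le> rrad leafed_fan + gdiam leafed_fan"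
    by (rule rdiam_le_rrad_plus_gdiam[OF leafed_fan_pair_graph leafed_fan_connected])
  have "cdim leafed_fan 5 \<le> rdiam leafed_fan"
    by (rule cdim_le_rdiam[OF leafed_fan_pair_graph]) (simp add: leafed_fan_pverts)
  with leafed_fan_cdim_leaf leafed_fan_rrad_le leafed_fan_gdiam_le
  show "rrad leafed_fan + gdiam leafed_fan \<le> rdiam leafed_fan" by linarith
qed

theorem proposition3p6:
  shows "(\<forall>G :: 'a pair_pre_digraph.
            pair_graph G \<and> Digraph_Component.connected (with_proj G) \<and> card (pverts G) \<ge> 2 \<longrightarrow>
              rrad G \<le> rdiam G \<and> rdiam G \<le> rrad G + gdiam G)
       \<and> (\<exists>G :: nat pair_pre_digraph.
            pair_graph G \<and> Digraph_Component.connected (with_proj G) \<and> card (pverts G) \<ge> 2 \<and>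
              rrad G = rdiam G)
       \<and> (\<exists>G :: nat pair_pre_digraph.
            pair_graph G \<and> Digraph_Component.connected (with_proj G) \<and> card (pverts G) \<ge> 2 \<and>
              rdiam G = rrad G + gdiam G)"
proof -
  have "2 \<le> card (pverts edge_graph)" "2 \<le> card (pverts leafed_fan)"
    by (simp_all add: edge_graph_def leafed_fan_pverts)
  then show ?thesis
    using rrad_le_rdiam rdiam_le_rrad_plus_gdiam edge_graph_pair_graph edge_graph_connected
      edge_graph_rrad_eq_rdiam leafed_fan_pair_graph leafed_fan_connected leafed_fan_rdiam_eq
    by blast
qed

end
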